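(* Let $X$ be a complex Banach space and let $T\in\mathcal{B}(X)$ be a power-bounded operator such that its numerical range $W_0(T)$ is a generalised Stolz domain with parameter $\alpha\ge1$. Then $\sigma(T)\cap\mathbb{T}\subseteq\{1\}$ and $$\|R(e^{i\theta},T)\|=O(|\theta|^{-\alpha}),\quad\theta\to0.$$
   Context: $\mathcal{B}(X)$ is the algebra of bounded linear operators on $X$; $T$ is power-bounded if $\sup_{n\ge1}\|T^n\|<\infty$; $\sigma(T)$ is the spectrum and $R(\lambda,T)=(\lambda I-T)^{-1}$ for $\lambda\notin\sigma(T)$. $\mathbb{D}=\{\lambda\in\mathbb{C}:|\lambda|<1\}$ and $\mathbb{T}=\{\lambda\in\mathbb{C}:|\lambda|=1\}$. The numerical range is $$W_0(T)=\{\phi(T):\phi\in\mathcal{B}(X)^*,\ \|\phi\|=\phi(I_X)=1\}.$$ A non-empty closed set $\Omega\subseteq\mathbb{D}\cup\{1\}$ is a *generalised Stolz domain with parameter $\alpha\ge1$* if there exist constants $c,\varepsilon>0$ such that $1-|\lambda|\ge c|\lambda-1|^{\alpha}$ for all $\lambda\in\Omega$ with $|\lambda-1|\le\varepsilon$. *)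

theory Defs
  imports "HOL-Analysis.Analysis" "HOL-Library.Landau_Symbols"
begin

section \<open>Complex Banach spaces\<close>

text \<open>
  The library only has real normed spaces. A complex normed space is a real one together with a
  complex scalar multiplication that extends the real one and makes the norm homogeneous
  (\<open>1 \<cdot> x = x\<close> follows from \<open>scaleC_of_real\<close>).
\<close>

class complex_normed_vector = real_normed_vector +
  fixes scaleC :: "complex \<Rightarrow> 'a \<Rightarrow> 'a" (infixr "*\<^sub>C" 75)
  assumes scaleC_add_right: "c *\<^sub>C (x + y) = c *\<^sub>C x + c *\<^sub>C y"
    and scaleC_add_left: "(c + d) *\<^sub>C x = c *\<^sub>C x + d *\<^sub>C x"
    and scaleC_scaleC: "c *\<^sub>C (d *\<^sub>C x) = (c * d) *\<^sub>C x"
    and scaleC_of_real: "complex_of_real r *\<^sub>C x = r *\<^sub>R x"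
    and norm_scaleC: "norm (c *\<^sub>C x) = cmod c * norm x"

class complex_banach = complex_normed_vector + banach

instantiation complex :: complex_banach
begin

definition scaleC_complex :: "complex \<Rightarrow> complex \<Rightarrow> complex"
  where "scaleC_complex c z = c * z"

instance
  by standard (auto simp: scaleC_complex_def algebra_simps norm_mult scaleR_conv_of_real)

end

section \<open>Bounded complex-linear operators\<close>

text \<open>
  The complex-linear members of the type of bounded real-linear maps. All operations, in
  particular the operator norm, are inherited from there.
\<close>

typedef (overloaded) ('a, 'b) cblinfun ("(_ \<Rightarrow>\<^sub>C\<^sub>L /_)" [22, 21] 21) =
  "{f :: 'a::complex_normed_vector \<Rightarrow>\<^sub>L 'b::complex_normed_vector.
      \<forall>c x. blinfun_apply f (c *\<^sub>C x) = c *\<^sub>C blinfun_apply f x}"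
  morphisms blinfun_of_cblinfun Abs_cblinfun
proof
  have "c *\<^sub>C (0::'b) = 0" for c
    using norm_scaleC[of c "0::'b"] by simp
  then show "0 \<in> {f :: 'a \<Rightarrow>\<^sub>L 'b. \<forall>c x. blinfun_apply f (c *\<^sub>C x) = c *\<^sub>C blinfun_apply f x}"
    by simp
qed

setup_lifting type_definition_cblinfun

lemma scaleC_zero_right [simp]: "c *\<^sub>C (0::'a::complex_normed_vector) = 0"
  using norm_scaleC[of c "0::'a"] by simp

lemma scaleC_minus_right: "c *\<^sub>C (- x) = - (c *\<^sub>C (x::'a::complex_normed_vector))"
  using scaleC_add_right[of c x "- x"] by (simp add: eq_neg_iff_add_eq_0 add.commute)

lemma scaleC_diff_right: "c *\<^sub>C (x - y) = c *\<^sub>C x - c *\<^sub>C (y::'a::complex_normed_vector)"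
  using scaleC_add_right[of c x "- y"] by (simp add: scaleC_minus_right)

lemma scaleC_left_commute: "c *\<^sub>C (d *\<^sub>C x) = d *\<^sub>C (c *\<^sub>C (x::'a::complex_normed_vector))"
  by (simp add: scaleC_scaleC mult.commute)

lemma scaleC_scaleR_commute: "c *\<^sub>C (r *\<^sub>R x) = r *\<^sub>R (c *\<^sub>C (x::'a::complex_normed_vector))"
  by (metis scaleC_of_real scaleC_left_commute)

lemma bounded_linear_scaleC:
  "bounded_linear (\<lambda>x. c *\<^sub>C (x::'a::complex_normed_vector))"
  by (rule bounded_linear_intro[where K = "cmod c"])
    (simp_all add: scaleC_add_right scaleC_scaleR_commute norm_scaleC mult.commute)

lift_definition cblinfun_apply ::
  "('a::complex_normed_vector \<Rightarrow>\<^sub>C\<^sub>L 'b::complex_normed_vector) \<Rightarrow> 'a \<Rightarrow> 'b"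
  is blinfun_apply .

lift_definition cblinfun_compose ::
  "('b::complex_normed_vector \<Rightarrow>\<^sub>C\<^sub>L 'c::complex_normed_vector)
    \<Rightarrow> ('a::complex_normed_vector \<Rightarrow>\<^sub>C\<^sub>L 'b) \<Rightarrow> ('a \<Rightarrow>\<^sub>C\<^sub>L 'c)" (infixl "o\<^sub>C\<^sub>L" 55)
  is blinfun_compose
  by simp

lift_definition id_cblinfun :: "'a::complex_normed_vector \<Rightarrow>\<^sub>C\<^sub>L 'a"
  is id_blinfun
  by simp

instantiation cblinfun :: (complex_normed_vector, complex_normed_vector) complex_normed_vector
begin

lift_definition zero_cblinfun :: "'a \<Rightarrow>\<^sub>C\<^sub>L 'b" is 0
  by simp

lift_definition plus_cblinfun :: "('a \<Rightarrow>\<^sub>C\<^sub>L 'b) \<Rightarrow> ('a \<Rightarrow>\<^sub>C\<^sub>L 'b) \<Rightarrow> ('a \<Rightarrow>\<^sub>C\<^sub>L 'b)" is "(+)"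
  by (simp add: plus_blinfun.rep_eq scaleC_add_right)

lift_definition minus_cblinfun :: "('a \<Rightarrow>\<^sub>C\<^sub>L 'b) \<Rightarrow> ('a \<Rightarrow>\<^sub>C\<^sub>L 'b) \<Rightarrow> ('a \<Rightarrow>\<^sub>C\<^sub>L 'b)" is "(-)"
  by (simp add: minus_blinfun.rep_eq scaleC_diff_right)

lift_definition uminus_cblinfun :: "('a \<Rightarrow>\<^sub>C\<^sub>L 'b) \<Rightarrow> ('a \<Rightarrow>\<^sub>C\<^sub>L 'b)" is uminus
  by (simp add: uminus_blinfun.rep_eq scaleC_minus_right)

lift_definition scaleR_cblinfun :: "real \<Rightarrow> ('a \<Rightarrow>\<^sub>C\<^sub>L 'b) \<Rightarrow> ('a \<Rightarrow>\<^sub>C\<^sub>L 'b)" is "(*\<^sub>R)"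
  by (simp add: scaleR_blinfun.rep_eq scaleC_scaleR_commute)

lift_definition scaleC_cblinfun :: "complex \<Rightarrow> ('a \<Rightarrow>\<^sub>C\<^sub>L 'b) \<Rightarrow> ('a \<Rightarrow>\<^sub>C\<^sub>L 'b)"
  is "\<lambda>c f. blinfun_compose (Blinfun ((*\<^sub>C) c)) f"
  by (simp add: bounded_linear_Blinfun_apply bounded_linear_scaleC scaleC_left_commute)

lift_definition norm_cblinfun :: "('a \<Rightarrow>\<^sub>C\<^sub>L 'b) \<Rightarrow> real" is norm .

definition dist_cblinfun :: "('a \<Rightarrow>\<^sub>C\<^sub>L 'b) \<Rightarrow> ('a \<Rightarrow>\<^sub>C\<^sub>L 'b) \<Rightarrow> real"
  where "dist_cblinfun f g = norm (f - g)"

definition sgn_cblinfun :: "('a \<Rightarrow>\<^sub>C\<^sub>L 'b) \<Rightarrow> ('a \<Rightarrow>\<^sub>C\<^sub>L 'b)"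
  where "sgn_cblinfun f = inverse (norm f) *\<^sub>R f"

definition uniformity_cblinfun :: "(('a \<Rightarrow>\<^sub>C\<^sub>L 'b) \<times> ('a \<Rightarrow>\<^sub>C\<^sub>L 'b)) filter"
  where "uniformity_cblinfun = (INF e\<in>{0<..}. principal {(f, g). dist f g < e})"

definition open_cblinfun :: "('a \<Rightarrow>\<^sub>C\<^sub>L 'b) set \<Rightarrow> bool"
  where "open_cblinfun S =
    (\<forall>f\<in>S. \<forall>\<^sub>F (f', g) in uniformity. f' = f \<longrightarrow> g \<in> S)"

instance
proof
  fix f g h :: "'a \<Rightarrow>\<^sub>C\<^sub>L 'b" and c d :: complex and r s :: real
  show "dist f g = norm (f - g)"
    by (rule dist_cblinfun_def)
  show "sgn f = inverse (norm f) *\<^sub>R f"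
    by (rule sgn_cblinfun_def)
  show "(uniformity :: (('a \<Rightarrow>\<^sub>C\<^sub>L 'b) \<times> ('a \<Rightarrow>\<^sub>C\<^sub>L 'b)) filter) =
      (INF e\<in>{0<..}. principal {(f, g). dist f g < e})"
    by (rule uniformity_cblinfun_def)
  show "open S = (\<forall>f\<in>S. \<forall>\<^sub>F (f', g) in uniformity. f' = f \<longrightarrow> g \<in> S)"
    for S :: "('a \<Rightarrow>\<^sub>C\<^sub>L 'b) set"
    by (rule open_cblinfun_def)
  show "f + g + h = f + (g + h)" by transfer (rule add.assoc)
  show "f + g = g + f" by transfer (rule add.commute)
  show "0 + f = f" by transfer simp
  show "- f + f = 0" by transfer simp
  show "f - g = f + - g" by transfer simp
  show "r *\<^sub>R (f + g) = r *\<^sub>R f + r *\<^sub>R g" by transfer (rule scaleR_add_right)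
  show "(r + s) *\<^sub>R f = r *\<^sub>R f + s *\<^sub>R f" by transfer (rule scaleR_add_left)
  show "r *\<^sub>R s *\<^sub>R f = (r * s) *\<^sub>R f" by transfer simp
  show "1 *\<^sub>R f = f" by transfer simp
  show "(norm f = 0) = (f = 0)" by transfer simp
  show "norm (f + g) \<le> norm f + norm g" by transfer (rule norm_triangle_ineq)
  show "norm (r *\<^sub>R f) = \<bar>r\<bar> * norm f" by transfer simp
  show "c *\<^sub>C (f + g) = c *\<^sub>C f + c *\<^sub>C g"
    by transfer (rule blinfun_eqI,
        simp add: bounded_linear_Blinfun_apply bounded_linear_scaleC blinfun.add_left scaleC_add_right)
  show "(c + d) *\<^sub>C f = c *\<^sub>C f + d *\<^sub>C f"
    by transfer (rule blinfun_eqI,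
        simp add: bounded_linear_Blinfun_apply bounded_linear_scaleC blinfun.add_left scaleC_add_left)
  show "c *\<^sub>C d *\<^sub>C f = (c * d) *\<^sub>C f"
    by transfer (rule blinfun_eqI,
        simp add: bounded_linear_Blinfun_apply bounded_linear_scaleC scaleC_scaleC)
  show "complex_of_real r *\<^sub>C f = r *\<^sub>R f"
    by transfer (rule blinfun_eqI,
        simp add: bounded_linear_Blinfun_apply bounded_linear_scaleC scaleC_of_real blinfun.scaleR_left)
  show "norm (c *\<^sub>C f) = cmod c * norm f"
  proof (transfer fixing: c)
    fix f :: "'a \<Rightarrow>\<^sub>L 'b"
    have "norm (blinfun_compose (Blinfun ((*\<^sub>C) c)) f)
        = (SUP x. norm (c *\<^sub>C blinfun_apply f x) / norm x)"
      by (simp add: norm_blinfun.rep_eq onorm_def bounded_linear_Blinfun_apply bounded_linear_scaleC)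
    also have "\<dots> = (SUP x. norm (cmod c *\<^sub>R blinfun_apply f x) / norm x)"
      by (simp add: norm_scaleC)
    also have "\<dots> = norm (cmod c *\<^sub>R f)"
      by (simp add: norm_blinfun.rep_eq onorm_def blinfun.scaleR_left)
    finally show "norm (blinfun_compose (Blinfun ((*\<^sub>C) c)) f) = cmod c * norm f"
      by simp
  qed
qed

end

lemma cblinfun_eqI: "(\<And>x. cblinfun_apply f x = cblinfun_apply g x) \<Longrightarrow> f = g"
  by transfer (rule blinfun_eqI)

lemma norm_cblinfun_onorm: "norm f = onorm (cblinfun_apply f)"
  by transfer (rule norm_blinfun.rep_eq)

lemma cblinfun_apply_simps:
  "cblinfun_apply 0 x = 0"
  "cblinfun_apply (f + g) x = cblinfun_apply f x + cblinfun_apply g x"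
  "cblinfun_apply (f - g) x = cblinfun_apply f x - cblinfun_apply g x"
  "cblinfun_apply (- f) x = - cblinfun_apply f x"
  "cblinfun_apply (r *\<^sub>R f) x = r *\<^sub>R cblinfun_apply f x"
  "cblinfun_apply (c *\<^sub>C f) x = c *\<^sub>C cblinfun_apply f x"
  "cblinfun_apply id_cblinfun x = x"
  "cblinfun_apply (h o\<^sub>C\<^sub>L f) x = cblinfun_apply h (cblinfun_apply f x)"
  by (transfer; simp add: blinfun.bilinear_simps bounded_linear_Blinfun_apply bounded_linear_scaleC)+

primrec cblinfun_power :: "('a::complex_normed_vector \<Rightarrow>\<^sub>C\<^sub>L 'a) \<Rightarrow> nat \<Rightarrow> ('a \<Rightarrow>\<^sub>C\<^sub>L 'a)" where
  "cblinfun_power T 0 = id_cblinfun"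
| "cblinfun_power T (Suc n) = T o\<^sub>C\<^sub>L cblinfun_power T n"

definition power_bounded :: "('a::complex_normed_vector \<Rightarrow>\<^sub>C\<^sub>L 'a) \<Rightarrow> bool" where
  "power_bounded T \<longleftrightarrow> bdd_above ((\<lambda>n. norm (cblinfun_power T n)) ` {1..})"

section \<open>Spectrum, resolvent and numerical range\<close>

definition cblinfun_inverses ::
    "('a::complex_normed_vector \<Rightarrow>\<^sub>C\<^sub>L 'a) \<Rightarrow> ('a \<Rightarrow>\<^sub>C\<^sub>L 'a) \<Rightarrow> bool" where
  "cblinfun_inverses S R \<longleftrightarrow> S o\<^sub>C\<^sub>L R = id_cblinfun \<and> R o\<^sub>C\<^sub>L S = id_cblinfun"

definition spectrum :: "('a::complex_normed_vector \<Rightarrow>\<^sub>C\<^sub>L 'a) \<Rightarrow> complex set" where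
  "spectrum T = {l. \<nexists>R. cblinfun_inverses (l *\<^sub>C id_cblinfun - T) R}"

text \<open>The value is unspecified for \<open>l\<close> in the spectrum.\<close>

definition resolvent :: "complex \<Rightarrow> ('a::complex_normed_vector \<Rightarrow>\<^sub>C\<^sub>L 'a) \<Rightarrow> ('a \<Rightarrow>\<^sub>C\<^sub>L 'a)" where
  "resolvent l T = (THE R. cblinfun_inverses (l *\<^sub>C id_cblinfun - T) R)"

lemma resolvent_eqI:
  assumes "cblinfun_inverses (l *\<^sub>C id_cblinfun - T) R"
  shows "resolvent l T = R"
  unfolding resolvent_def
proof (rule the_equality[where P = "cblinfun_inverses (l *\<^sub>C id_cblinfun - T)", OF assms])
  fix R' assume *: "cblinfun_inverses (l *\<^sub>C id_cblinfun - T) R'"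
  have inv: "cblinfun_apply R' (cblinfun_apply (l *\<^sub>C id_cblinfun - T) y) = y"
    "cblinfun_apply (l *\<^sub>C id_cblinfun - T) (cblinfun_apply R y) = y" for y
    using assms * by (metis cblinfun_inverses_def cblinfun_apply_simps(7,8))+
  show "R' = R"
    by (rule cblinfun_eqI) (metis inv)
qed

definition numerical_range :: "('a::complex_normed_vector \<Rightarrow>\<^sub>C\<^sub>L 'a) \<Rightarrow> complex set" where
  "numerical_range T =
    {cblinfun_apply \<phi> T |\<phi> :: ('a \<Rightarrow>\<^sub>C\<^sub>L 'a) \<Rightarrow>\<^sub>C\<^sub>L complex.
      norm \<phi> = 1 \<and> cblinfun_apply \<phi> id_cblinfun = 1}"

definition generalised_Stolz_domain :: "real \<Rightarrow> complex set \<Rightarrow> bool" where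
  "generalised_Stolz_domain \<alpha> \<Omega> \<longleftrightarrow>
    \<alpha> \<ge> 1 \<and> \<Omega> \<noteq> {} \<and> closed \<Omega> \<and> \<Omega> \<subseteq> ball 0 1 \<union> {1} \<and>
    (\<exists>c>0. \<exists>\<epsilon>>0. \<forall>l\<in>\<Omega>. cmod (l - 1) \<le> \<epsilon> \<longrightarrow> 1 - cmod l \<ge> c * cmod (l - 1) powr \<alpha>)"

end

theory Submission
  imports Defs
begin

text \<open>
  If \<open>\<parallel>x\<parallel> = 1\<close> and \<open>\<psi>\<close> is a norming functional of \<open>x\<close> (Hahn-Banach), then \<open>S \<mapsto> \<psi> (S x)\<close> is a
  functional as in the definition of the numerical range, whence
  \<open>\<parallel>(\<lambda> - T) x\<parallel> \<ge> dist \<lambda> (W\<^sub>0 T) \<cdot> \<parallel>x\<parallel>\<close>. For \<open>\<bar>\<lambda>\<bar> = 1\<close> with \<open>\<lambda> \<noteq> 1\<close> this bound persists at \<open>r\<lambda>\<close>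
  for \<open>r > 1\<close> near \<open>1\<close>, where \<open>r\<lambda> - T\<close> is onto by the Neumann series, and letting \<open>r \<rightarrow> 1\<close> shows
  that \<open>\<lambda> - T\<close> is onto. So \<open>\<parallel>R(\<lambda>,T)\<parallel>\<close> is at most the reciprocal of the distance of \<open>\<lambda>\<close> to the
  numerical range, and the Stolz condition bounds this distance from below by a multiple of
  \<open>\<bar>\<lambda> - 1\<bar> powr \<alpha>\<close>.
\<close>

section \<open>Norming functionals\<close>

text \<open>Homogeneity is an inequality for positive factors, easy to verify for infima;
  \<open>sublinear_scaleR\<close> recovers equality and the factor 0.\<close>

definition sublinear :: "('a::real_vector \<Rightarrow> real) \<Rightarrow> bool" where
  "sublinear p \<longleftrightarrow>
    (\<forall>x y. p (x + y) \<le> p x + p y) \<and> (\<forall>r>0. \<forall>x. p (r *\<^sub>R x) \<le> r * p x)"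

lemma sublinearD:
  assumes "sublinear p"
  shows "p (x + y) \<le> p x + p y" and "r > 0 \<Longrightarrow> p (r *\<^sub>R x) \<le> r * p x"
  using assms by (auto simp: sublinear_def)

lemma sublinear_scaleR:
  assumes p: "sublinear p" and r: "r \<ge> 0"
  shows "p (r *\<^sub>R x) = r * p x"
proof (cases "r = 0")
  case True
  \<comment> \<open>The factors 2 and 1/2 at the zero vector squeeze \<open>p 0\<close> to
    0.\<close>
  have "p (0::'a) \<le> 2 * p 0" "p (0::'a) \<le> (1/2) * p 0"
    using sublinearD(2)[OF p, of 2 0] sublinearD(2)[OF p, of "1/2" 0] by auto
  then show ?thesis using True by simp
next
  case False
  with r have r: "r > 0" by simp
  have "p ((1/r) *\<^sub>R (r *\<^sub>R x)) \<le> (1/r) * p (r *\<^sub>R x)"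
    using sublinearD(2)[OF p] r by (metis zero_less_divide_1_iff)
  then have "r * p x \<le> p (r *\<^sub>R x)"
    using r by (simp add: field_simps)
  with sublinearD(2)[OF p r, of x] show ?thesis by simp
qed

text \<open>Subadditivity at \<open>x + (- x)\<close> with \<open>p 0 = 0\<close>. It bounds from
  below all sublinear functionals under a given one, so that infima over chains make sense.\<close>

lemma sublinear_minus_le:
  assumes "sublinear p"
  shows "- p (- x) \<le> p x"
  using sublinearD(1)[OF assms, of x "- x"] sublinear_scaleR[OF assms, of 0 x] by simp

text \<open>
  A minimal sublinear \<open>p\<close> coincides with \<open>q\<close> for every \<open>y\<close>, which forces additivity; and any linear
  functional below the \<open>q\<close> built from the norm is norming for \<open>y\<close>.
\<close>

lemma sublinear_shift_Inf:
  fixes p :: "'a::real_vector \<Rightarrow> real" and y :: 'a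
  assumes p: "sublinear p"
  defines "q \<equiv> \<lambda>x. INF t\<in>{0..}. p (x + t *\<^sub>R y) - t * p y"
  shows "sublinear q" and "q x \<le> p x" and "q (- y) \<le> - p y" and "q x \<le> p (x + y) - p y"
proof -
  have bdd: "bdd_below ((\<lambda>t. p (x + t *\<^sub>R y) - t * p y) ` {0..})" for x
  proof (rule bdd_belowI2)
    fix t :: real assume "t \<in> {0..}"
    then show "- p (- x) \<le> p (x + t *\<^sub>R y) - t * p y"
      using sublinearD(1)[OF p, of "x + t *\<^sub>R y" "- x"] sublinear_scaleR[OF p, of t y] by simp
  qed
  have le: "q x \<le> p (x + t *\<^sub>R y) - t * p y" if "t \<ge> 0" for x t
    unfolding q_def using that by (intro cINF_lower bdd) auto
  have ge: "c \<le> q x" if "\<And>t. t \<ge> 0 \<Longrightarrow> c \<le> p (x + t *\<^sub>R y) - t * p y" for c x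
    unfolding q_def using that by (intro cINF_greatest) auto
  show "q x \<le> p x" using le[of 0 x] by simp
  show "q (- y) \<le> - p y"
    using le[of 1 "- y"] sublinear_scaleR[OF p, of 0 y] by simp
  show "q x \<le> p (x + y) - p y" using le[of 1 x] by simp
  show "sublinear q"
    unfolding sublinear_def
  proof (intro conjI allI impI)
    fix x z
    \<comment> \<open>Candidates for \<open>x\<close> and \<open>z\<close> with parameters
      \<open>s\<close> and \<open>t\<close> dominate the candidate for \<open>x + z\<close> with
      parameter \<open>s + t\<close>; the two infima are then taken one after the other.\<close>
    have *: "q (x + z) - (p (z + t *\<^sub>R y) - t * p y) \<le> p (x + s *\<^sub>R y) - s * p y"
      if "s \<ge> 0" "t \<ge> 0" for s t
    proof -
      have "q (x + z) \<le> p (x + z + (s + t) *\<^sub>R y) - (s + t) * p y"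
        using that by (intro le) simp
      also have "x + z + (s + t) *\<^sub>R y = (x + s *\<^sub>R y) + (z + t *\<^sub>R y)"
        by (simp add: algebra_simps)
      finally show ?thesis
        using sublinearD(1)[OF p, of "x + s *\<^sub>R y" "z + t *\<^sub>R y"] by (simp add: algebra_simps)
    qed
    have "q (x + z) - q x \<le> p (z + t *\<^sub>R y) - t * p y" if "t \<ge> 0" for t
      using ge[of "q (x + z) - (p (z + t *\<^sub>R y) - t * p y)" x] *[of _ t] that by simp
    then show "q (x + z) \<le> q x + q z"
      using ge[of "q (x + z) - q x" z] by simp
  next
    fix r :: real and x assume r: "r > 0"
    \<comment> \<open>The candidate for \<open>r *\<^sub>R x\<close> at parameter
      \<open>r * t\<close> is \<open>r\<close> times the candidate for \<open>x\<close> at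
      \<open>t\<close>.\<close>
    have "q (r *\<^sub>R x) / r \<le> p (x + t *\<^sub>R y) - t * p y" if "t \<ge> 0" for t
    proof -
      have "q (r *\<^sub>R x) \<le> p (r *\<^sub>R x + (r * t) *\<^sub>R y) - (r * t) * p y"
        using that r by (intro le) simp
      also have "r *\<^sub>R x + (r * t) *\<^sub>R y = r *\<^sub>R (x + t *\<^sub>R y)"
        by (simp add: algebra_simps)
      also have "p \<dots> = r * p (x + t *\<^sub>R y)"
        using sublinear_scaleR[OF p, of r] r by simp
      finally show ?thesis using r by (simp add: field_simps)
    qed
    then have "q (r *\<^sub>R x) / r \<le> q x" by (rule ge)
    then show "q (r *\<^sub>R x) \<le> r * q x" using r by (simp add: field_simps)
  qed
qed

text \<open>Minimality makes the shifted infimum equal to \<open>p\<close>, and its candidate at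
  \<open>t = 1\<close> then gives the missing inequality \<open>p x + p y \<le> p (x + y)\<close>.
  Negative factors follow from additivity.\<close>

lemma minimal_sublinear_linear:
  assumes p: "sublinear p" and min: "\<And>q. sublinear q \<Longrightarrow> q \<le> p \<Longrightarrow> q = p"
  shows "linear p"
proof -
  have add: "p (x + y) = p x + p y" for x y
  proof -
    let ?q = "\<lambda>x. INF t\<in>{0..}. p (x + t *\<^sub>R y) - t * p y"
    have "?q = p"
      by (rule min) (rule le_funI sublinear_shift_Inf[OF p])+
    then have "p x = ?q x" by (rule fun_cong[OF sym])
    also have "\<dots> \<le> p (x + y) - p y" by (rule sublinear_shift_Inf(4)[OF p])
    finally show ?thesis using sublinearD(1)[OF p, of x y] by simp
  qed
  have minus: "p (- x) = - p x" for x
    using add[of x "- x"] sublinear_scaleR[OF p, of 0 x] by simp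
  have "p (r *\<^sub>R x) = r * p x" for r x
  proof (cases "r \<ge> 0")
    case True
    then show ?thesis using p sublinear_scaleR by blast
  next
    case False
    then have "p (- r *\<^sub>R x) = - r * p x" by (intro sublinear_scaleR[OF p]) simp
    then show ?thesis using minus[of "r *\<^sub>R x"] by simp
  qed
  with add show ?thesis by (intro linearI) auto
qed

text \<open>Provides the lower bounds of chains for Zorn's lemma. The chain condition enters in
  subadditivity: two members \<open>q\<close> and \<open>r\<close> are both replaced by the smaller
  one.\<close>

lemma sublinear_chain_Inf:
  assumes C: "C \<noteq> {}" "\<And>q. q \<in> C \<Longrightarrow> sublinear q" "\<And>q. q \<in> C \<Longrightarrow> q \<le> p"
    and chain: "\<And>q r. q \<in> C \<Longrightarrow> r \<in> C \<Longrightarrow> q \<le> r \<or> r \<le> q"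
  defines "u \<equiv> \<lambda>x. INF q\<in>C. q x"
  shows "sublinear u" and "\<And>q. q \<in> C \<Longrightarrow> u \<le> q"
proof -
  have bdd: "bdd_below ((\<lambda>q. q x) ` C)" for x
  proof (rule bdd_belowI2)
    fix q assume q: "q \<in> C"
    then show "- p (- x) \<le> q x"
      using sublinear_minus_le[OF C(2)[OF q], of x] le_funD[OF C(3)[OF q], of "- x"] by simp
  qed
  have le: "u x \<le> q x" if "q \<in> C" for q x
    unfolding u_def using that by (intro cINF_lower bdd)
  have ge: "c \<le> u x" if "\<And>q. q \<in> C \<Longrightarrow> c \<le> q x" for c x
    unfolding u_def using that C(1) by (intro cINF_greatest) auto
  show "u \<le> q" if "q \<in> C" for q
    using le[OF that] by (simp add: le_fun_def)
  show "sublinear u"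
    unfolding sublinear_def
  proof (intro conjI allI impI)
    fix x y
    have *: "u (x + y) \<le> q x + r y" if qr: "q \<in> C" "r \<in> C" for q r
    proof -
      obtain s where s: "s \<in> C" "s \<le> q" "s \<le> r"
        using chain[OF qr] qr by auto
      have "u (x + y) \<le> s x + s y"
        using le[OF s(1), of "x + y"] sublinearD(1)[OF C(2)[OF s(1)], of x y] by simp
      then show ?thesis using le_funD[OF s(2), of x] le_funD[OF s(3), of y] by simp
    qed
    have "u (x + y) - q x \<le> u y" if "q \<in> C" for q
      using *[OF that] by (intro ge) (simp add: algebra_simps)
    then show "u (x + y) \<le> u x + u y"
      using ge[of "u (x + y) - u y" x] by (simp add: algebra_simps)
  next
    fix r :: real and x assume r: "r > 0"
    have "u (r *\<^sub>R x) / r \<le> q x" if q: "q \<in> C" for q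
      using le[OF q, of "r *\<^sub>R x"] sublinearD(2)[OF C(2)[OF q] r, of x] r
      by (simp add: field_simps)
    then have "u (r *\<^sub>R x) / r \<le> u x" by (rule ge)
    then show "u (r *\<^sub>R x) \<le> r * u x" using r by (simp add: field_simps)
  qed
qed

lemma sublinear_dominates_linear:
  fixes p :: "'a::real_vector \<Rightarrow> real"
  assumes p: "sublinear p"
  obtains f where "linear f" "f \<le> p"
proof -
  let ?A = "{q. sublinear q \<and> q \<le> p}"
  have "\<exists>m\<in>?A. \<forall>a\<in>?A. a \<le> m \<longrightarrow> a = m"
  \<comment> \<open>The pointwise order is reversed, so that maximal elements become minimal
    functionals.\<close>
  proof (rule predicate_Zorn)
    show "partial_order_on ?A (relation_of (\<lambda>a b. b \<le> a) ?A)"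
      by (rule partial_order_on_relation_ofI) auto
    fix C assume C: "C \<in> Chains (relation_of (\<lambda>a b. b \<le> a) ?A)"
    then have CA: "C \<subseteq> ?A" and chain: "\<And>q r. q \<in> C \<Longrightarrow> r \<in> C \<Longrightarrow> q \<le> r \<or> r \<le> q"
      unfolding Chains_def relation_of_def by blast+
    show "\<exists>u\<in>?A. \<forall>a\<in>C. u \<le> a"
    proof (cases "C = {}")
      \<comment> \<open>The infimum over an empty chain carries no information; \<open>p\<close>
        itself is the bound.\<close>
      case True
      then show ?thesis using p by auto
    next
      case False
      define u where "u = (\<lambda>x. INF q\<in>C. q x)"
      have "sublinear u" "\<And>q. q \<in> C \<Longrightarrow> u \<le> q"
        unfolding u_def using CA chain False by (intro sublinear_chain_Inf[where p = p]; blast)+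
      moreover obtain q where "q \<in> C" "q \<le> p" using False CA by blast
      ultimately show ?thesis
        by (intro bexI[of _ u]) (auto intro: order_trans[of u q p])
    qed
  qed
  then obtain m where m: "sublinear m" "m \<le> p"
    and min: "\<forall>a\<in>?A. a \<le> m \<longrightarrow> a = m"
    by blast
  have "linear m"
    using m(1)
  proof (rule minimal_sublinear_linear)
    fix a assume "sublinear a" "a \<le> m"
    then show "a = m" using min m(2) order_trans[of a m p] by blast
  qed
  then show thesis using m(2) by (rule that)
qed

text \<open>A linear functional under the shifted infimum of the norm in direction \<open>x\<close>
  is at most \<open>- norm x\<close> at \<open>- x\<close>; linearity turns this into
  \<open>f x \<ge> norm x\<close>.\<close>

lemma real_norming_functional:
  fixes x :: "'a::real_normed_vector"
  shows "\<exists>f. linear f \<and> (\<forall>z. f z \<le> norm z) \<and> f x = norm x"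
proof -
  have n: "sublinear (norm :: 'a \<Rightarrow> real)"
    by (auto simp: sublinear_def norm_triangle_ineq)
  obtain f where f: "linear f"
    and le: "f \<le> (\<lambda>z. INF t\<in>{0..}. norm (z + t *\<^sub>R x) - t * norm x)"
    using sublinear_dominates_linear[OF sublinear_shift_Inf(1)[OF n]] .
  have norm: "f z \<le> norm z" for z
    using order_trans[OF le_funD[OF le] sublinear_shift_Inf(2)[OF n]] .
  have "f (- x) \<le> - norm x"
    using order_trans[OF le_funD[OF le] sublinear_shift_Inf(3)[OF n]] .
  then have "norm x \<le> f x" using linear_neg[OF f, of x] by simp
  with norm[of x] have "f x = norm x" by simp
  with f norm show ?thesis by (intro exI[of _ f]) simp
qed

text \<open>The standard complexification: \<open>f z - \<i> * f (\<i> *\<^sub>C z)\<close> is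
  complex-linear with real part \<open>f\<close>.\<close>

lemma complex_norming_functional:
  fixes x :: "'a::complex_normed_vector"
  shows "\<exists>\<psi>. (\<forall>y z. \<psi> (y + z) = \<psi> y + \<psi> z) \<and> (\<forall>c z. \<psi> (c *\<^sub>C z) = c * \<psi> z) \<and>
    (\<forall>z. cmod (\<psi> z) \<le> norm z) \<and> \<psi> x = norm x"
proof -
  obtain f where f: "linear f" and norm: "\<And>z. f z \<le> norm z" and x: "f x = norm (x::'a)"
    using real_norming_functional[of x] by metis
  define \<psi> where "\<psi> z = Complex (f z) (- f (\<i> *\<^sub>C z))" for z
  have add: "\<psi> (y + z) = \<psi> y + \<psi> z" for y z
    by (simp add: \<psi>_def complex_eq_iff linear_add[OF f] scaleC_add_right)
  have real: "f (complex_of_real r *\<^sub>C z) = r * f z" for r z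
    by (simp add: scaleC_of_real linear_scale[OF f])
  have scale: "\<psi> (c *\<^sub>C z) = c * \<psi> z" for c z
  proof -
    \<comment> \<open>Used for \<open>c\<close> and for \<open>\<i> * c\<close>, this gives the real
      and the imaginary part.\<close>
    have "f (c *\<^sub>C z) = Re c * f z + Im c * f (\<i> *\<^sub>C z)" for c z
    proof -
      have "c *\<^sub>C z = of_real (Re c) *\<^sub>C z + of_real (Im c) *\<^sub>C \<i> *\<^sub>C z"
        by (metis complex_eq mult.commute scaleC_add_left scaleC_scaleC)
      then show ?thesis by (simp only: linear_add[OF f] real)
    qed
    from this[of c z] this[of "\<i> * c" z] show ?thesis
      by (simp add: \<psi>_def complex_eq_iff scaleC_scaleC)
  qed
  have bound: "cmod (\<psi> z) \<le> norm z" for z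
  proof (cases "\<psi> z = 0")
    case False
    \<comment> \<open>Rotation by \<open>c\<close> makes \<open>\<psi> (c *\<^sub>C z)\<close> real
      and nonnegative, where it agrees with \<open>f\<close> and the real bound applies.\<close>
    define c where "c = cnj (sgn (\<psi> z))"
    have c1: "cmod c = 1"
      using False unfolding c_def complex_mod_cnj by (simp add: norm_sgn)
    have "c * \<psi> z = \<psi> z * cnj (\<psi> z) / cmod (\<psi> z)"
      by (simp add: c_def sgn_eq)
    also have "\<dots> = cmod (\<psi> z)"
      using False by (simp flip: complex_norm_square add: power2_eq_square)
    finally have c: "c * \<psi> z = cmod (\<psi> z)" .
    have "cmod (\<psi> z) = Re (\<psi> (c *\<^sub>C z))" by (simp add: scale c)
    also have "\<dots> \<le> norm (c *\<^sub>C z)" using norm by (simp add: \<psi>_def)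
    finally show ?thesis by (simp add: norm_scaleC c1)
  qed simp
  have "Re (\<psi> x) = norm x" by (simp add: \<psi>_def x)
  \<comment> \<open>The real part already exhausts the bound on the modulus.\<close>
  moreover from this have "Im (\<psi> x) = 0"
    using bound[of x] norm_complex_def
    by (smt (verit) cmod_power2 norm_ge_zero power2_less_eq_zero_iff power_mono)
  ultimately have "\<psi> x = norm x" by (simp add: complex_eq_iff)
  with add scale bound show ?thesis by (intro exI[of _ \<psi>]) simp
qed

section \<open>The numerical range and lower bounds\<close>

lemma norm_cblinfun_le:
  assumes "b \<ge> 0" "\<And>x. norm (cblinfun_apply f x) \<le> b * norm x"
  shows "norm f \<le> b"
  unfolding norm_cblinfun_onorm using assms by (rule onorm_bound)

lemma bounded_linear_cblinfun_apply: "bounded_linear (cblinfun_apply f)"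
  by transfer (rule blinfun.bounded_linear_right)

lemma cblinfun_apply_diff_right: "cblinfun_apply f (x - y) = cblinfun_apply f x - cblinfun_apply f y"
  by (rule linear_diff[OF bounded_linear.linear[OF bounded_linear_cblinfun_apply]])

lemma cblinfun_apply_scaleC_right: "cblinfun_apply f (c *\<^sub>C x) = c *\<^sub>C cblinfun_apply f x"
  by transfer simp

lemma norm_cblinfun_apply: "norm (cblinfun_apply f x) \<le> norm f * norm x"
  by transfer (rule norm_blinfun)

lemma cblinfun_applyI:
  assumes "\<And>x y. f (x + y) = f x + f y" "\<And>c x. f (c *\<^sub>C x) = c *\<^sub>C f x"
    and "\<And>x. norm (f x) \<le> norm x * K"
  obtains F where "cblinfun_apply F = f"
proof -
  have bl: "bounded_linear f"
    by (rule bounded_linear_intro[of _ K]) (use assms in \<open>simp_all flip: scaleC_of_real\<close>)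
  then have "blinfun_of_cblinfun (Abs_cblinfun (Blinfun f)) = Blinfun f"
    using assms(2) by (intro Abs_cblinfun_inverse) (simp add: bounded_linear_Blinfun_apply)
  then have "cblinfun_apply (Abs_cblinfun (Blinfun f)) = f"
    using bl by (simp add: cblinfun_apply.rep_eq bounded_linear_Blinfun_apply)
  then show thesis by (rule that)
qed

lemma numerical_range_vector:
  fixes T :: "'a::complex_normed_vector \<Rightarrow>\<^sub>C\<^sub>L 'a"
  assumes x: "norm x = 1"
  obtains w where "w \<in> numerical_range T"
    "cmod (l - w) \<le> norm (cblinfun_apply (l *\<^sub>C id_cblinfun - T) x)"
proof -
  obtain \<psi> where \<psi>: "\<And>y z. \<psi> (y + z) = \<psi> y + \<psi> z"
    "\<And>c z. \<psi> (c *\<^sub>C z) = c * \<psi> z" "\<And>z. cmod (\<psi> z) \<le> norm z" "\<psi> x = norm x"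
    using complex_norming_functional[of x] by metis
  have le: "cmod (\<psi> (cblinfun_apply S x)) \<le> norm S" for S :: "'a \<Rightarrow>\<^sub>C\<^sub>L 'a"
    using \<psi>(3)[of "cblinfun_apply S x"] norm_cblinfun_apply[of S x] x by simp
  obtain \<phi> :: "('a \<Rightarrow>\<^sub>C\<^sub>L 'a) \<Rightarrow>\<^sub>C\<^sub>L complex"
    where \<phi>: "cblinfun_apply \<phi> = (\<lambda>S. \<psi> (cblinfun_apply S x))"
    by (rule cblinfun_applyI[of "\<lambda>S. \<psi> (cblinfun_apply S x)" 1])
      (simp_all add: cblinfun_apply_simps \<psi>(1,2) scaleC_complex_def le)
  have id: "cblinfun_apply \<phi> id_cblinfun = 1"
    by (simp add: \<phi> cblinfun_apply_simps \<psi>(4) x)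
  have "norm (id_cblinfun :: 'a \<Rightarrow>\<^sub>C\<^sub>L 'a) \<le> 1"
    by (rule norm_cblinfun_le) (simp_all add: cblinfun_apply_simps)
  \<comment> \<open>The value 1 at an operator of norm at most 1 forces this.\<close>
  then have "1 \<le> norm \<phi>"
    using norm_cblinfun_apply[of \<phi> id_cblinfun] id
    by (smt (verit) mult_left_le norm_ge_zero norm_one)
  moreover have "norm \<phi> \<le> 1"
    by (rule norm_cblinfun_le) (simp_all add: \<phi> le)
  ultimately have "cblinfun_apply \<phi> T \<in> numerical_range T"
    using id unfolding numerical_range_def by force
  moreover have "l - cblinfun_apply \<phi> T = cblinfun_apply \<phi> (l *\<^sub>C id_cblinfun - T)"
    by (simp add: cblinfun_apply_diff_right cblinfun_apply_scaleC_right id scaleC_complex_def)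
  then have "cmod (l - cblinfun_apply \<phi> T) \<le> norm (cblinfun_apply (l *\<^sub>C id_cblinfun - T) x)"
    using \<psi>(3) by (simp add: \<phi>)
  ultimately show thesis by (rule that)
qed

lemma numerical_range_lower_bound:
  fixes T :: "'a::complex_normed_vector \<Rightarrow>\<^sub>C\<^sub>L 'a"
  assumes "\<And>w. w \<in> numerical_range T \<Longrightarrow> d \<le> cmod (l - w)"
  shows "d * norm x \<le> norm (cblinfun_apply (l *\<^sub>C id_cblinfun - T) x)"
proof (cases "x = 0")
  case False
  define y where "y = (1 / norm x) *\<^sub>R x"
  have "norm y = 1" using False by (simp add: y_def)
  then obtain w where "w \<in> numerical_range T"
    "cmod (l - w) \<le> norm (cblinfun_apply (l *\<^sub>C id_cblinfun - T) y)"
    by (rule numerical_range_vector)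
  with assms have "d \<le> norm (cblinfun_apply (l *\<^sub>C id_cblinfun - T) y)"
    by force
  also have "\<dots> = norm (cblinfun_apply (l *\<^sub>C id_cblinfun - T) x) / norm x"
    by (simp add: y_def linear_scale[OF bounded_linear.linear[OF bounded_linear_cblinfun_apply]])
  finally show ?thesis using False by (simp add: field_simps)
qed simp

text \<open>The lower bound gives injectivity, hence linearity of the set-theoretic inverse, and
  applied to \<open>g y\<close> it bounds that inverse by \<open>1 / d\<close>.\<close>

lemma cblinfun_inverses_of_lower_bound:
  fixes S :: "'a::complex_normed_vector \<Rightarrow>\<^sub>C\<^sub>L 'a"
  assumes d: "d > 0" and lb: "\<And>x. d * norm x \<le> norm (cblinfun_apply S x)"
    and surj: "surj (cblinfun_apply S)"
  obtains R where "cblinfun_inverses S R" "norm R \<le> 1 / d"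
proof -
  interpret S: bounded_linear "cblinfun_apply S" by (rule bounded_linear_cblinfun_apply)
  have inj: "x = y" if "cblinfun_apply S x = cblinfun_apply S y" for x y
    using lb[of "x - y"] that d by (simp add: S.diff mult_le_0_iff)
  define g where "g = inv (cblinfun_apply S)"
  have g: "cblinfun_apply S (g y) = y" for y
    using surj by (simp add: g_def surj_f_inv_f)
  have gn: "norm (g y) \<le> norm y * (1 / d)" for y
    using lb[of "g y"] d by (simp add: g field_simps)
  have "g (x + y) = g x + g y" for x y
    by (rule inj) (simp add: g S.add)
  moreover have "g (c *\<^sub>C x) = c *\<^sub>C g x" for c x
    by (rule inj) (simp add: g cblinfun_apply_scaleC_right)
  ultimately obtain R where R: "cblinfun_apply R = g"
    using gn by (rule cblinfun_applyI)
  show thesis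
  proof
    show "cblinfun_inverses S R"
      unfolding cblinfun_inverses_def
      by (intro conjI cblinfun_eqI; (rule inj)?) (simp_all add: cblinfun_apply_simps R g)
    show "norm R \<le> 1 / d"
      by (rule norm_cblinfun_le) (use gn d in \<open>simp_all add: R\<close>)
  qed
qed

section \<open>Power-bounded operators\<close>

text \<open>The preimage of \<open>y\<close> is the Neumann series with terms \<open>a n\<close>,
  dominated by a geometric series because the powers of \<open>T\<close> are bounded.\<close>

lemma power_bounded_surj_outside:
  fixes T :: "'a::complex_banach \<Rightarrow>\<^sub>C\<^sub>L 'a"
  assumes pb: "power_bounded T" and l: "cmod l > 1"
  shows "surj (cblinfun_apply (l *\<^sub>C id_cblinfun - T))"
proof -
  interpret T: bounded_linear "cblinfun_apply T" by (rule bounded_linear_cblinfun_apply)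
  obtain M where M: "\<And>n. n \<ge> 1 \<Longrightarrow> norm (cblinfun_power T n) \<le> M"
    using pb by (auto simp: power_bounded_def bdd_above_def)
  have "\<exists>x. cblinfun_apply (l *\<^sub>C id_cblinfun - T) x = y" for y
  proof -
    define a where "a n = (inverse l ^ Suc n) *\<^sub>C cblinfun_apply (cblinfun_power T n) y" for n
    have "summable a"
    proof (rule summable_comparison_test')
      show "summable (\<lambda>n. (M * norm y) * inverse (cmod l) ^ Suc n)"
        using l by (intro summable_mult summable_Suc_iff[THEN iffD2] summable_geometric)
          (simp add: inverse_less_1_iff)
      \<comment> \<open>The bound \<open>M\<close> is available from exponent 1 on, so the
        comparison skips the term at 0.\<close>
      fix n :: nat assume n: "n \<ge> 1"
      have "norm (cblinfun_apply (cblinfun_power T n) y) \<le> M * norm y"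
        using norm_cblinfun_apply[of "cblinfun_power T n" y] M[OF n]
        by (meson mult_right_mono norm_ge_zero order_trans)
      then have "inverse (cmod l) ^ Suc n * norm (cblinfun_apply (cblinfun_power T n) y)
          \<le> inverse (cmod l) ^ Suc n * (M * norm y)"
        by (intro mult_left_mono) auto
      then show "norm (a n) \<le> (M * norm y) * inverse (cmod l) ^ Suc n"
        unfolding a_def norm_scaleC norm_power norm_inverse by (simp only: mult.commute)
    qed
    \<comment> \<open>\<open>T\<close> sends \<open>a n\<close> to
      \<open>l *\<^sub>C a (Suc n)\<close>, so the series telescopes to
      \<open>l *\<^sub>C a 0 = y\<close>.\<close>
    have "l *\<^sub>C a n - cblinfun_apply T (a n) = l *\<^sub>C a n - l *\<^sub>C a (Suc n)" for n
    proof -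
      have "l * inverse l ^ Suc (Suc n) = inverse l ^ Suc n"
        using l by (auto simp: field_simps)
      then show ?thesis
        unfolding a_def by (simp only: scaleC_scaleC cblinfun_power.simps cblinfun_apply_simps
            cblinfun_apply_scaleC_right)
    qed
    moreover have "(\<lambda>n. l *\<^sub>C a n - l *\<^sub>C a (Suc n)) sums (l *\<^sub>C a 0 - l *\<^sub>C 0)"
      by (intro telescope_sums' bounded_linear.tendsto[OF bounded_linear_scaleC]
          summable_LIMSEQ_zero \<open>summable a\<close>)
    moreover have "l *\<^sub>C a 0 = y"
    proof -
      have "l \<noteq> 0" using l by auto
      then show ?thesis
        using scaleC_of_real[of 1 y] by (simp add: a_def scaleC_scaleC cblinfun_apply_simps)
    qed
    moreover have "(\<lambda>n. l *\<^sub>C a n - cblinfun_apply T (a n))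
        sums (l *\<^sub>C suminf a - cblinfun_apply T (suminf a))"
      using \<open>summable a\<close>
      by (intro sums_diff bounded_linear.sums[OF bounded_linear_scaleC] T.sums summable_sums)
    ultimately have "l *\<^sub>C suminf a - cblinfun_apply T (suminf a) = y"
      by (simp add: sums_unique2)
    then show ?thesis by (auto simp: cblinfun_apply_simps)
  qed
  then show ?thesis by (metis surjI)
qed

text \<open>The equation is solved at the points \<open>(1 + s n) * l\<close> outside the disc; the
  lower bound at \<open>l\<close> makes the solutions bounded and then Cauchy, and completeness
  gives a solution at \<open>l\<close>.\<close>

lemma power_bounded_surj_circle:
  fixes T :: "'a::complex_banach \<Rightarrow>\<^sub>C\<^sub>L 'a"
  assumes pb: "power_bounded T" and l: "cmod l = 1" and d: "d > 0"
    and lb: "\<And>x. d * norm x \<le> norm (cblinfun_apply (l *\<^sub>C id_cblinfun - T) x)"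
  shows "surj (cblinfun_apply (l *\<^sub>C id_cblinfun - T))"
proof -
  let ?S = "cblinfun_apply (l *\<^sub>C id_cblinfun - T)"
  interpret S: bounded_linear ?S by (rule bounded_linear_cblinfun_apply)
  have "\<exists>x. ?S x = y" for y
  proof -
    \<comment> \<open>The cap \<open>d / 2\<close> lets half of the lower bound absorb the
      perturbation, which yields \<open>2 * norm y / d\<close> below.\<close>
    define s where "s n = d / 2 / real (Suc n)" for n
    have s: "0 < s n" "s n \<le> d / 2" for n
      using d by (auto simp: s_def field_simps)
    have s0: "s \<longlonglongrightarrow> 0"
      unfolding s_def by (intro LIMSEQ_Suc lim_const_over_n)
    have "\<exists>x. ?S x + (s n *\<^sub>R (l *\<^sub>C x)) = y" for n
    proof -
      have "cmod (of_real (1 + s n) * l) > 1"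
        using s[of n] l by (simp add: norm_mult del: of_real_add)
      from power_bounded_surj_outside[OF pb this] obtain x
        where "cblinfun_apply ((of_real (1 + s n) * l) *\<^sub>C id_cblinfun - T) x = y"
        by (metis surjD)
      then have "(of_real (1 + s n) * l) *\<^sub>C x - cblinfun_apply T x = y"
        by (simp add: cblinfun_apply_simps)
      moreover have "(of_real (1 + s n) * l) *\<^sub>C x = l *\<^sub>C x + s n *\<^sub>R (l *\<^sub>C x)"
        by (metis scaleC_scaleC scaleC_of_real scaleR_add_left scaleR_one)
      ultimately show ?thesis
        by (intro exI[of _ x]) (simp add: cblinfun_apply_simps algebra_simps)
    qed
    then obtain x where x: "\<And>n. ?S (x n) + s n *\<^sub>R (l *\<^sub>C x n) = y" by metis
    have bound: "norm (x n) \<le> 2 * norm y / d" for n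
    proof -
      have "d * norm (x n) \<le> norm (y - s n *\<^sub>R (l *\<^sub>C x n))"
        using lb[of "x n"] x[of n] by (metis add_diff_cancel_right')
      also have "\<dots> \<le> norm y + s n * norm (x n)"
        using norm_triangle_ineq4[of y "s n *\<^sub>R (l *\<^sub>C x n)"] s[of n] l
        by (simp add: norm_scaleC)
      also have "\<dots> \<le> norm y + d / 2 * norm (x n)"
        by (intro add_left_mono mult_right_mono s norm_ge_zero)
      finally show ?thesis using d by (simp add: field_simps)
    qed
    have "(\<lambda>n. s n *\<^sub>R (l *\<^sub>C x n)) \<longlonglongrightarrow> 0"
    proof (rule Lim_null_comparison)
      show "\<forall>\<^sub>F n in sequentially. norm (s n *\<^sub>R (l *\<^sub>C x n)) \<le> s n * (2 * norm y / d)"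
      proof (intro always_eventually allI)
        fix n
        have "s n * norm (x n) \<le> s n * (2 * norm y / d)"
          using s(1)[of n] bound by (intro mult_left_mono) auto
        then show "norm (s n *\<^sub>R (l *\<^sub>C x n)) \<le> s n * (2 * norm y / d)"
          using s(1)[of n] l by (simp add: norm_scaleC)
      qed
      show "(\<lambda>n. s n * (2 * norm y / d)) \<longlonglongrightarrow> 0"
        using tendsto_mult_left_zero[OF s0] .
    qed
    from tendsto_diff[OF tendsto_const[of y] this]
    have "(\<lambda>n. y - s n *\<^sub>R (l *\<^sub>C x n)) \<longlonglongrightarrow> y" by simp
    moreover have "y - s n *\<^sub>R (l *\<^sub>C x n) = ?S (x n)" for n
      using x[of n] by (metis add_diff_cancel_right')
    ultimately have Sx: "(\<lambda>n. ?S (x n)) \<longlonglongrightarrow> y" by simp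
    \<comment> \<open>The lower bound carries the Cauchy property of the images back to
      \<open>x\<close>.\<close>
    have "Cauchy x"
    proof (rule metric_CauchyI)
      fix e :: real assume "e > 0"
      then obtain N where N: "\<And>m n. m \<ge> N \<Longrightarrow> n \<ge> N \<Longrightarrow> dist (?S (x m)) (?S (x n)) < d * e"
        using metric_CauchyD[OF LIMSEQ_imp_Cauchy[OF Sx], of "d * e"] d by auto
      have "dist (x m) (x n) < e" if "m \<ge> N" "n \<ge> N" for m n
      proof -
        have "d * norm (x m - x n) < d * e"
          using lb[of "x m - x n"] N[OF that] by (simp add: S.diff dist_norm)
        then show ?thesis using d by (simp add: dist_norm)
      qed
      then show "\<exists>N. \<forall>m\<ge>N. \<forall>n\<ge>N. dist (x m) (x n) < e" by blast
    qed
    then obtain z where "x \<longlonglongrightarrow> z" by (auto simp: Cauchy_convergent_iff convergent_def)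
    then show ?thesis
      using LIMSEQ_unique[OF S.tendsto Sx] by blast
  qed
  then show ?thesis by (metis surjI)
qed

lemma power_bounded_resolvent_bound:
  fixes T :: "'a::complex_banach \<Rightarrow>\<^sub>C\<^sub>L 'a"
  assumes "power_bounded T" "cmod l = 1" "d > 0"
    and "\<And>w. w \<in> numerical_range T \<Longrightarrow> d \<le> cmod (l - w)"
  shows "l \<notin> spectrum T" and "norm (resolvent l T) \<le> 1 / d"
proof -
  note lb = numerical_range_lower_bound[OF assms(4)]
  obtain R where R: "cblinfun_inverses (l *\<^sub>C id_cblinfun - T) R" "norm R \<le> 1 / d"
    using cblinfun_inverses_of_lower_bound[OF assms(3) lb
        power_bounded_surj_circle[OF assms(1-3) lb]] .
  then show "l \<notin> spectrum T" "norm (resolvent l T) \<le> 1 / d"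
    by (auto simp: spectrum_def resolvent_eqI)
qed

section \<open>Distance to a generalised Stolz domain\<close>

text \<open>With \<open>t\<close> half the distance from \<open>l\<close> to 1, points
  \<open>w\<close> closer to 1 than \<open>t\<close> are far from \<open>l\<close> by the triangle
  inequality, as are those beyond \<open>\<epsilon>\<close>; for the others the Stolz condition
  bounds \<open>1 - cmod w\<close>, hence \<open>cmod (l - w)\<close>.\<close>

lemma generalised_Stolz_domain_distance:
  assumes "generalised_Stolz_domain \<alpha> \<Omega>"
  obtains k \<delta> where "k > 0" "\<delta> > 0"
    "\<And>l w. cmod l = 1 \<Longrightarrow> cmod (l - 1) \<le> \<delta> \<Longrightarrow> w \<in> \<Omega> \<Longrightarrow>
      k * (cmod (l - 1) / 2) powr \<alpha> \<le> cmod (l - w)"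
proof -
  obtain c \<epsilon> where \<alpha>: "\<alpha> \<ge> 1" and c: "c > 0" and \<epsilon>: "\<epsilon> > 0"
    and S: "\<And>w. w \<in> \<Omega> \<Longrightarrow> cmod (w - 1) \<le> \<epsilon> \<Longrightarrow> c * cmod (w - 1) powr \<alpha> \<le> 1 - cmod w"
    using assms by (auto simp: generalised_Stolz_domain_def)
  show thesis
  proof
    \<comment> \<open>The 1 in the minimum serves the two triangle inequality cases,
      \<open>c\<close> the Stolz case. Halving \<open>\<epsilon>\<close> keeps \<open>l\<close> at
      distance over \<open>\<epsilon> / 2\<close> from the points beyond
      \<open>\<epsilon>\<close>.\<close>
    show "min c 1 > 0" "\<epsilon> / 2 > 0" using c \<epsilon> by auto
    fix l w assume l: "cmod l = 1" and le: "cmod (l - 1) \<le> \<epsilon> / 2" and w: "w \<in> \<Omega>"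
    define t where "t = cmod (l - 1) / 2"
    have t: "0 \<le> t" "t \<le> 1"
      using norm_triangle_ineq4[of l 1] l by (auto simp: t_def)
    \<comment> \<open>Since \<open>t \<le> 1\<close> and \<open>\<alpha> \<ge> 1\<close>, linear
      bounds in \<open>t\<close> are strong enough.\<close>
    have pt: "t powr \<alpha> \<le> t"
      using powr_mono'[of 1 \<alpha> t] t \<alpha> by simp
    have m: "min c 1 * t powr \<alpha> \<le> t powr \<alpha>" "min c 1 * t powr \<alpha> \<le> c * t powr \<alpha>"
      using mult_right_mono[of "min c 1" 1 "t powr \<alpha>"]
        mult_right_mono[of "min c 1" c "t powr \<alpha>"] by auto
    have tri: "2 * t \<le> cmod (l - w) + cmod (w - 1)"
      using norm_triangle_ineq[of "l - w" "w - 1"] by (simp add: t_def)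
    consider "cmod (w - 1) < t" | "cmod (w - 1) > \<epsilon>" | "t \<le> cmod (w - 1)" "cmod (w - 1) \<le> \<epsilon>"
      by linarith
    then have "min c 1 * t powr \<alpha> \<le> cmod (l - w)"
    proof cases
      case 1
      then show ?thesis using tri pt m by linarith
    next
      case 2
      have "cmod (w - 1) \<le> cmod (l - w) + 2 * t"
        using norm_triangle_ineq4[of "l - 1" "l - w"] by (simp add: t_def)
      moreover have "2 * t \<le> \<epsilon> / 2" using le by (simp add: t_def)
      ultimately show ?thesis using 2 pt m t by linarith
    next
      case 3
      have "c * t powr \<alpha> \<le> c * cmod (w - 1) powr \<alpha>"
        using 3 t c \<alpha> by (intro mult_left_mono powr_mono2) auto
      also have "\<dots> \<le> 1 - cmod w" using S w 3 by blast
      also have "\<dots> \<le> cmod (l - w)" using norm_triangle_ineq2[of l w] l by simp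
      finally show ?thesis using m by linarith
    qed
    then show "min c 1 * (cmod (l - 1) / 2) powr \<alpha> \<le> cmod (l - w)" by (simp add: t_def)
  qed
qed

text \<open>Translates distance from 1 on the circle into the angle: the imaginary part is
  \<open>sin \<theta>\<close>, and the difference quotient of sine at 0 tends to 1.\<close>

lemma eventually_cmod_exp_minus_one_ge:
  "\<forall>\<^sub>F \<theta>::real in at 0. \<bar>\<theta>\<bar> / 2 \<le> cmod (exp (\<i> * of_real \<theta>) - 1)"
proof -
  have "((\<lambda>\<theta>::real. \<bar>sin \<theta> / \<theta>\<bar>) \<longlongrightarrow> 1) (at 0)"
    using tendsto_rabs[OF DERIV_sin[of "0::real", unfolded DERIV_def]] by simp
  then have "\<forall>\<^sub>F \<theta>::real in at 0. 1 / 2 < \<bar>sin \<theta> / \<theta>\<bar>"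
    by (rule order_tendstoD) simp
  moreover have "\<forall>\<^sub>F \<theta>::real in at 0. \<theta> \<noteq> 0"
    by (simp add: eventually_at_filter)
  ultimately show ?thesis
  proof eventually_elim
    case (elim \<theta>)
    then have "\<bar>\<theta>\<bar> / 2 \<le> \<bar>sin \<theta>\<bar>" by (simp add: field_simps)
    also have "\<dots> = \<bar>Im (exp (\<i> * of_real \<theta>) - 1)\<bar>" by (simp add: Im_exp)
    also have "\<dots> \<le> cmod (exp (\<i> * of_real \<theta>) - 1)" by (rule abs_Im_le_cmod)
    finally show ?case .
  qed
qed

section \<open>Spectrum and resolvent growth on the unit circle\<close>

theorem proposition3p2:
  fixes T :: "'a::complex_banach \<Rightarrow>\<^sub>C\<^sub>L 'a" and \<alpha> :: real
  assumes "\<alpha> \<ge> 1"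
    and "power_bounded T"
    and "generalised_Stolz_domain \<alpha> (numerical_range T)"
  shows "spectrum T \<inter> sphere 0 1 \<subseteq> {1} \<and>
    (\<lambda>\<theta>::real. norm (resolvent (exp (\<i> * of_real \<theta>)) T)) \<in> O[at 0](\<lambda>\<theta>. \<bar>\<theta>\<bar> powr (- \<alpha>))"
proof
  let ?W = "numerical_range T"
  show "spectrum T \<inter> sphere 0 1 \<subseteq> {1}"
  proof (rule subsetI, rule ccontr)
    fix l assume l: "l \<in> spectrum T \<inter> sphere 0 1" "l \<notin> {1}"
    have "closed ?W" "?W \<subseteq> ball 0 1 \<union> {1}"
      using assms(3) by (auto simp: generalised_Stolz_domain_def)
    moreover from this l have "l \<notin> ?W" by auto
    \<comment> \<open>A distance depending on \<open>l\<close> is enough here, and closedness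
      supplies it; the growth estimate needs the quantitative bound instead.\<close>
    ultimately obtain d where "d > 0" "\<And>w. w \<in> ?W \<Longrightarrow> d \<le> dist l w"
      using separate_point_closed[of ?W l] by metis
    then show False
      using power_bounded_resolvent_bound(1)[OF assms(2), of l d] l by (simp add: dist_norm)
  qed
  obtain k \<delta> where k: "k > 0" and \<delta>: "\<delta> > 0"
    and dist: "\<And>l w. cmod l = 1 \<Longrightarrow> cmod (l - 1) \<le> \<delta> \<Longrightarrow> w \<in> ?W \<Longrightarrow>
      k * (cmod (l - 1) / 2) powr \<alpha> \<le> cmod (l - w)"
    using generalised_Stolz_domain_distance[OF assms(3)] by blast
  have "((\<lambda>\<theta>::real. cmod (exp (\<i> * of_real \<theta>) - 1)) \<longlongrightarrow> cmod (exp (\<i> * of_real 0) - 1)) (at 0)"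
    by (intro tendsto_intros)
  then have "\<forall>\<^sub>F \<theta>::real in at 0. cmod (exp (\<i> * of_real \<theta>) - 1) < \<delta>"
    using \<delta> by (intro order_tendstoD) auto
  moreover have "\<forall>\<^sub>F \<theta>::real in at 0. \<theta> \<noteq> 0"
    by (simp add: eventually_at_filter)
  ultimately have "\<forall>\<^sub>F \<theta>::real in at 0. norm (norm (resolvent (exp (\<i> * of_real \<theta>)) T))
      \<le> (4 powr \<alpha> / k) * norm (\<bar>\<theta>\<bar> powr (- \<alpha>))"
    using eventually_cmod_exp_minus_one_ge
  proof eventually_elim
    case (elim \<theta>)
    let ?l = "exp (\<i> * of_real \<theta>) :: complex"
    \<comment> \<open>The 4 combines the half in the distance estimate with the half in the
      comparison of chord and angle; it becomes the constant
      \<open>4 powr \<alpha> / k\<close>.\<close>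
    have "k * (\<bar>\<theta>\<bar> / 4) powr \<alpha> \<le> k * (cmod (?l - 1) / 2) powr \<alpha>"
      using elim k assms(1) by (intro mult_left_mono powr_mono2) auto
    also have "k * (cmod (?l - 1) / 2) powr \<alpha> \<le> cmod (?l - w)" if "w \<in> ?W" for w
      using that elim by (intro dist) auto
    finally have "norm (resolvent ?l T) \<le> 1 / (k * (\<bar>\<theta>\<bar> / 4) powr \<alpha>)"
      \<comment> \<open>Positivity of the distance bound comes from
        \<open>\<theta> \<noteq> 0\<close>.\<close>
      using k elim by (intro power_bounded_resolvent_bound(2)[OF assms(2)]) auto
    also have "\<dots> = (4 powr \<alpha> / k) * \<bar>\<theta>\<bar> powr (- \<alpha>)"
      by (simp add: powr_divide powr_minus field_simps)
    finally show ?case by simp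
  qed
  then show "(\<lambda>\<theta>::real. norm (resolvent (exp (\<i> * of_real \<theta>)) T)) \<in> O[at 0](\<lambda>\<theta>. \<bar>\<theta>\<bar> powr (- \<alpha>))"
    by (rule bigoI)
qed

end
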